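(* Consider the generalized preferential attachment hypergraph model with hyperedge sizes $Y_t$ and new-node counts $X_t$, whose limiting means $\overline{X}=\lim_{t\to\infty}E[X_t]$ and $\overline{Y}=\lim_{t\to\infty}E[Y_t]$ are finite and strictly positive, and suppose $p=\overline{X}/\overline{Y}\in(0,1)$. In the mean-field thermodynamic limit ($t\to\infty$), the stationary hyperdegree distribution $P$ of the model (the time-independent solution of the limiting mean-field master equation defined in the context) is $$P(d_H)=\frac{\Gamma(d_H)\,\Gamma\!\left(\frac{1}{1-p}+1\right)}{(1-p)\,\Gamma\!\left(\frac{1}{1-p}+d_H+1\right)}\qquad\text{for every integer } d_H\ge 1.$$ Moreover $P$ has a power-law tail: there is a constant $C>0$ (depending on $p$) such that $P(d_H)\,d_H^{\gamma}\to C$ as $d_H\to\infty$, where $\gamma=\frac{1}{1-p}+1\in(2,\infty)$. In particular the exponent $\gamma$ depends only on $p$, and not on the shapes of the distributions of $X_t$ and $Y_t$ beyond their means.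
   Context: **Model.** A hypergraph consists of a node set and a collection of hyperedges (subsets of nodes); the hyperdegree $d(v)$ of a node $v$ is the number of hyperedges containing it. The generalized preferential attachment model grows a hypergraph as follows. At each timestep $t$: (1) sample $Y_t$ from a distribution over the positive integers; (2) sample $X_t$ from a distribution over $\{0,1,\dots,Y_t\}$; (3) select $Y_t-X_t$ pre-existing nodes without replacement, with probability of selecting $u$ proportional to $d(u)/\sum_{v\in V}d(v)$; (4) add a new hyperedge of size $Y_t$ consisting of $X_t$ newly added nodes and the $Y_t-X_t$ selected pre-existing nodes. The sequences $(X_t)$ and $(Y_t)$ are each i.i.d. in $t$. Write $|V_t|=\sum_{i=1}^t X_i$ for the number of nodes and $D_t=\sum_{i=1}^t Y_i$ for the total hyperdegree at time $t$. By the strong law of large numbers $|V_t|/t\to\overline{X}$ and $D_t/t\to\overline{Y}$ almost surely. **Mean-field approximate master equation.** Let $v_{(i,j)}$ be the $j$-th node added at time $i$ ($1\le j\le X_i$) and let $P(d_H,v_{(i,j)},t)$ be the probability that it has hyperdegree $d_H$ at time $t$. In the mean-field approximation, $Y_t-X_t$ is replaced by its expectation and the $Y_t-X_t$ preferential selections are treated as independent events each hitting a node of hyperdegree $d_H$ with probability $d_H/D_t$, so that $$P(d_H,v_{(i,j)},t+1)=\frac{(d_H-1)(Y_t-X_t)}{D_t}P(d_H-1,v_{(i,j)},t)+\Bigl(1-\frac{d_H(Y_t-X_t)}{D_t}\Bigr)P(d_H,v_{(i,j)},t).$$ Each newly added node has hyperdegree $1$. The time-dependent hyperdegree distribution is the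 average over nodes, $P(d_H,t)=\frac{1}{|V_t|}\sum_{i=1}^t\sum_{j=1}^{X_i}P(d_H,v_{(i,j)},t)$, and therefore satisfies, for $d_H\ge 1$, $$|V_{t+1}|P(d_H,t+1)=(d_H-1)(Y_t-X_t)\frac{|V_t|}{D_t}P(d_H-1,t)+\Bigl(1-\frac{d_H(Y_t-X_t)}{D_t}\Bigr)|V_t|P(d_H,t)+X_{t+1}\,\mathbf 1[d_H=1].$$ **Thermodynamic limit and stationarity.** The mean-field thermodynamic limit consists of replacing the random quantities in the last equation by their deterministic limits: $X_{t+1}$ by $\overline{X}$, $Y_t-X_t$ by $\overline{Y}-\overline{X}$, $|V_t|$ by $\overline{X}t$ and $D_t$ by $\overline{Y}t$. The stationary hyperdegree distribution is the function $P(d_H)$, $d_H\ge1$, such that the time-independent choice $P(d_H,t)=P(d_H)$ solves the resulting equation $$\overline{X}(t+1)P(d_H,t+1)=(d_H-1)(\overline{Y}-\overline{X})\frac{\overline{X}}{\overline{Y}}P(d_H-1,t)+\Bigl(1-\frac{d_H(\overline{Y}-\overline{X})}{\overline{Y}t}\Bigr)\overline{X}t\,P(d_H,t)+\overline{X}\,\mathbf 1[d_H=1]$$ for all integers $d_H\ge1$ and all $t\ge1$ (the first term on the right is $0$ when $d_H=1$). $\Gamma$ denotes Euler's gamma function. *)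

theory Defs
  imports "HOL-Probability.Probability" "HOL-Combinatorics.Multiset_Permutations"
begin

section \<open>The growth model\<close>

text \<open>
  Nodes are natural numbers, numbered in order of arrival, so that the nodes present after
  timestep \<open>t\<close> are \<open>{..<num_nodes x t}\<close>. A realised hypergraph is a sequence of hyperedges,
  the \<open>i\<close>-th one (\<open>i \<ge> 1\<close>) being added at timestep \<open>i\<close>; nothing is present at time \<open>0\<close>.
\<close>

definition num_nodes :: "(nat \<Rightarrow> nat) \<Rightarrow> nat \<Rightarrow> nat" where
  "num_nodes x t = (\<Sum>i=1..t. x i)"

definition hyperdegree :: "(nat \<Rightarrow> nat set) \<Rightarrow> nat \<Rightarrow> nat \<Rightarrow> nat" where
  "hyperdegree e t v = card {i \<in> {1..t}. v \<in> e i}"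

text \<open>
  \<open>draw_prob w U us\<close> is the probability that successive draws from \<open>U\<close> without replacement,
  each proportional to the weights \<open>w\<close> of the elements not yet drawn, give the list \<open>us\<close>.
\<close>

fun draw_prob :: "('v \<Rightarrow> nat) \<Rightarrow> 'v set \<Rightarrow> 'v list \<Rightarrow> real" where
  "draw_prob w U [] = 1"
| "draw_prob w U (u # us) =
     real (w u) / (\<Sum>v\<in>U. real (w v)) * draw_prob w (U - {u}) us"

definition selection_prob :: "('v \<Rightarrow> nat) \<Rightarrow> 'v set \<Rightarrow> 'v set \<Rightarrow> real" where
  "selection_prob w U S = (\<Sum>us\<in>permutations_of_set S. draw_prob w U us)"

text \<open>
  \<open>X t\<close> and \<open>Y t\<close> are the number of new nodes and the prescribed hyperedge size at timestep
  \<open>t \<ge> 1\<close>, and \<open>E t\<close> is the hyperedge added then. The two sequences are i.i.d. separately; no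
  joint independence is required, since \<open>X t\<close> is bounded by \<open>Y t\<close>. Given the past and the
  current sizes, \<open>E (Suc t)\<close> consists of all new nodes and of a set \<open>S\<close> of old nodes drawn by
  preferential attachment. If fewer than \<open>Y (Suc t) - X (Suc t)\<close> old nodes exist (inevitable
  for small \<open>t\<close>, as there are none at \<open>t = 0\<close>), all of them are selected.
\<close>

locale pref_attachment_hypergraph = prob_space M
  for M :: "'a measure"
    and X Y :: "nat \<Rightarrow> 'a \<Rightarrow> nat"
    and E :: "nat \<Rightarrow> 'a \<Rightarrow> nat set" +
  assumes indep_X: "indep_vars (\<lambda>_. count_space UNIV) X {1..}"
    and indep_Y: "indep_vars (\<lambda>_. count_space UNIV) Y {1..}"
    and identical_X: "\<And>i j. 1 \<le> i \<Longrightarrow> 1 \<le> j \<Longrightarrow>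
      distr M (count_space UNIV) (X i) = distr M (count_space UNIV) (X j)"
    and identical_Y: "\<And>i j. 1 \<le> i \<Longrightarrow> 1 \<le> j \<Longrightarrow>
      distr M (count_space UNIV) (Y i) = distr M (count_space UNIV) (Y j)"
    and Y_pos: "\<And>t. 1 \<le> t \<Longrightarrow> AE \<omega> in M. 1 \<le> Y t \<omega>"
    and X_le_Y: "\<And>t. 1 \<le> t \<Longrightarrow> AE \<omega> in M. X t \<omega> \<le> Y t \<omega>"
    and measurable_E: "\<And>t. 1 \<le> t \<Longrightarrow> E t \<in> measurable M (count_space UNIV)"
    and preferential_attachment: "\<And>t x y e S.
      \<lbrakk> S \<subseteq> {..<num_nodes x t};
        card S = min (y (Suc t) - x (Suc t)) (num_nodes x t) \<rbrakk> \<Longrightarrow>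
      prob {\<omega> \<in> space M.
          (\<forall>i\<in>{1..t}. E i \<omega> = e i) \<and> (\<forall>i\<in>{1..Suc t}. X i \<omega> = x i \<and> Y i \<omega> = y i) \<and>
          E (Suc t) \<omega> = {num_nodes x t..<num_nodes x (Suc t)} \<union> S} =
      prob {\<omega> \<in> space M.
          (\<forall>i\<in>{1..t}. E i \<omega> = e i) \<and> (\<forall>i\<in>{1..Suc t}. X i \<omega> = x i \<and> Y i \<omega> = y i)} *
      selection_prob (hyperdegree e t) {..<num_nodes x t} S"

definition has_limiting_mean :: "'a measure \<Rightarrow> (nat \<Rightarrow> 'a \<Rightarrow> nat) \<Rightarrow> real \<Rightarrow> bool" where
  "has_limiting_mean M Z m \<longleftrightarrow>
     (\<forall>t\<ge>1. integrable M (\<lambda>\<omega>. real (Z t \<omega>))) \<and>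
     (\<lambda>t. \<integral>\<omega>. real (Z t \<omega>) \<partial>M) \<longlonglongrightarrow> m"

section \<open>Mean-field master equation\<close>

text \<open>
  The master equation for the hyperdegree distribution \<open>P d t\<close>, in terms of the number \<open>V t\<close>
  of nodes, the total hyperdegree \<open>D t\<close>, the number \<open>s t\<close> of preferential selections made in
  passing from \<open>t\<close> to \<open>t + 1\<close>, and the number \<open>n t\<close> of nodes added at time \<open>t\<close>. The value
  \<open>P 0 t\<close> only occurs with coefficient \<open>0\<close>.
\<close>

definition master_equation ::
  "(nat \<Rightarrow> real) \<Rightarrow> (nat \<Rightarrow> real) \<Rightarrow> (nat \<Rightarrow> real) \<Rightarrow> (nat \<Rightarrow> real) \<Rightarrow> (nat \<Rightarrow> nat \<Rightarrow> real) \<Rightarrow> bool"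
where
  "master_equation V D s n P \<longleftrightarrow>
     (\<forall>d\<ge>1. \<forall>t\<ge>1.
        V (t + 1) * P d (t + 1) =
          (real d - 1) * s t * (V t / D t) * P (d - 1) t
          + (1 - real d * s t / D t) * V t * P d t
          + n (t + 1) * of_bool (d = 1))"

text \<open>
  Thermodynamic limit: for means \<open>\<mu>\<close> of \<open>X\<close> and \<open>\<nu>\<close> of \<open>Y\<close>, the random quantities are
  replaced by their deterministic limits.
\<close>

definition limit_master_equation :: "real \<Rightarrow> real \<Rightarrow> (nat \<Rightarrow> nat \<Rightarrow> real) \<Rightarrow> bool" where
  "limit_master_equation \<mu> \<nu> =
     master_equation (\<lambda>t. \<mu> * real t) (\<lambda>t. \<nu> * real t) (\<lambda>_. \<nu> - \<mu>) (\<lambda>_. \<mu>)"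

lemma limit_master_equation_iff:
  "limit_master_equation \<mu> \<nu> P \<longleftrightarrow>
     (\<forall>d\<ge>1. \<forall>t\<ge>1.
        \<mu> * (real t + 1) * P d (t + 1) =
          (real d - 1) * (\<nu> - \<mu>) * (\<mu> / \<nu>) * P (d - 1) t
          + (1 - real d * (\<nu> - \<mu>) / (\<nu> * real t)) * (\<mu> * real t) * P d t
          + \<mu> * of_bool (d = 1))"
  unfolding limit_master_equation_def master_equation_def
  by (auto simp: algebra_simps)

definition stationary_hyperdegree_distribution :: "real \<Rightarrow> real \<Rightarrow> (nat \<Rightarrow> real) \<Rightarrow> bool" where
  "stationary_hyperdegree_distribution \<mu> \<nu> P \<longleftrightarrow> limit_master_equation \<mu> \<nu> (\<lambda>d t. P d)"

end

theory Submission
  imports Defs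
begin

text \<open>
  Put \<open>q = 1 - p = (\<nu> - \<mu>) / \<nu>\<close>, the share of the total hyperdegree that is created by
  preferential attachment. For a time-independent \<open>P\<close> the variable \<open>t\<close> drops out of the limiting
  master equation: of \<open>\<mu> (t + 1) P d\<close> on the left, \<open>\<mu> t P d\<close> cancels against the right, and the
  loss term \<open>d q / t\<close> is multiplied by \<open>\<mu> t\<close>. What remains is the first-order recurrence
  \<open>(1 + q d) P d = q (d - 1) P (d - 1) + [d = 1]\<close>, in which \<open>\<mu>\<close> and \<open>\<nu>\<close> occur only through
  \<open>q\<close> (\<open>stationary_iff_recurrence\<close>). It forces \<open>P 1 = 1 / (1 + q)\<close> and
  \<open>P (d + 1) / P d = d / (d + 1 + 1 / q)\<close>, so it has exactly one solution, a quotient of rising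
  factorials that the functional equation of \<open>\<Gamma>\<close> identifies with the stated one
  (\<open>recurrence_iff_Gamma_ratio\<close>).

  The power law is Gauss's product formula for \<open>\<Gamma>\<close>: with \<open>\<gamma> = 1 / q + 1\<close>, the sequence
  \<open>\<Gamma> d \<Gamma> \<gamma> d\<^sup>\<gamma> / \<Gamma> (\<gamma> + d)\<close> is \<open>(d - 1)! d\<^sup>\<gamma> / (\<gamma> (\<gamma> + 1) \<dots> (\<gamma> + d - 1))\<close>, and hence
  tends to \<open>\<Gamma> \<gamma>\<close> (\<open>Gamma_ratio_power_tail\<close>). The constant is \<open>C = \<Gamma> \<gamma> / q\<close>; as it depends on
  \<open>p\<close> alone, one \<open>C\<close> serves all models with the same \<open>p\<close>.
\<close>

text \<open>
  The two equations differ by the factor \<open>\<mu>\<close> once \<open>\<mu> t P d\<close> is cancelled, for every \<open>t \<ge> 1\<close>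
  alike; so the family of equations indexed by \<open>t\<close> amounts to a single one for each \<open>d\<close>.
\<close>
lemma stationary_iff_recurrence:
  fixes \<mu> \<nu> :: real
  assumes "0 < \<mu>" and "0 < \<nu>"
  shows "stationary_hyperdegree_distribution \<mu> \<nu> P \<longleftrightarrow>
    (\<forall>d\<ge>1. (1 + (1 - \<mu> / \<nu>) * real d) * P d =
            (1 - \<mu> / \<nu>) * (real d - 1) * P (d - 1) + of_bool (d = 1))"
proof -
  have "\<mu> * (real t + 1) * P d =
          (real d - 1) * (\<nu> - \<mu>) * (\<mu> / \<nu>) * P (d - 1)
          + (1 - real d * (\<nu> - \<mu>) / (\<nu> * real t)) * (\<mu> * real t) * P d
          + \<mu> * of_bool (d = 1) \<longleftrightarrow>
        (1 + (1 - \<mu> / \<nu>) * real d) * P d =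
          (1 - \<mu> / \<nu>) * (real d - 1) * P (d - 1) + of_bool (d = 1)"
    (is "?lhs = ?rhs \<longleftrightarrow> ?lhs' = ?rhs'") if "1 \<le> t" for d t :: nat
  proof -
    have "?lhs - ?rhs = \<mu> * (?lhs' - ?rhs')"
      using assms that by (simp add: field_simps)
    then show ?thesis
      using assms by auto
  qed
  then show ?thesis
    unfolding stationary_hyperdegree_distribution_def limit_master_equation_iff
    by (metis order_refl)
qed

text \<open>
  At \<open>d = 1\<close> the coefficient of \<open>P (d - 1)\<close> vanishes, so the recurrence starts at \<open>P 1\<close> and
  leaves \<open>P 0\<close> free. Since \<open>1 + q d\<close> never vanishes, each value determines the next one. The
  \<open>\<Gamma>\<close> ratio fits because raising \<open>d\<close> by one multiplies its numerator by \<open>d\<close> and its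
  denominator by \<open>1 / q + d + 1 = (1 + q (d + 1)) / q\<close>.
\<close>
lemma recurrence_iff_Gamma_ratio:
  fixes q :: real and P :: "nat \<Rightarrow> real"
  assumes "0 < q"
  shows "(\<forall>d\<ge>1. (1 + q * real d) * P d = q * (real d - 1) * P (d - 1) + of_bool (d = 1)) \<longleftrightarrow>
    (\<forall>d\<ge>1. P d = Gamma (real d) * Gamma (1 / q + 1) / (q * Gamma (1 / q + real d + 1)))"
    (is "?rec P \<longleftrightarrow> (\<forall>d\<ge>1. P d = ?G d)")
proof -
  have nonpole: "x \<notin> \<int>\<^sub>\<le>\<^sub>0" if "0 < x" for x :: real
    using that by (auto elim!: nonpos_Ints_cases)
  have start: "(1 + q) * ?G 1 = 1"
  proof -
    have "Gamma (1 / q + 1 + 1) = (1 / q + 1) * Gamma (1 / q + 1)"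
      using assms by (intro Gamma_plus1 nonpole) (simp add: add_pos_pos)
    then have denom: "q * Gamma (1 / q + real 1 + 1) = (1 + q) * Gamma (1 / q + 1)"
      using assms by (simp add: field_simps)
    have "Gamma (1 / q + 1) > 0"
      using assms by (intro Gamma_real_pos) (simp add: add_pos_pos)
    then show ?thesis
      unfolding denom using assms by simp
  qed
  have step: "(1 + q * real (Suc d)) * ?G (Suc d) = q * real d * ?G d" if "1 \<le> d" for d
  proof -
    have "Gamma (1 / q + real d + 1 + 1) = (1 / q + real d + 1) * Gamma (1 / q + real d + 1)"
      using assms by (intro Gamma_plus1 nonpole) (simp add: add_pos_nonneg)
    then have denom: "q * Gamma (1 / q + real (Suc d) + 1) =
        (1 + q * real (Suc d)) * Gamma (1 / q + real d + 1)"
      using assms by (simp add: field_simps)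
    have numer: "Gamma (real (Suc d)) = real d * Gamma (real d)"
      using Gamma_plus1[of "real d"] nonpole that by (simp add: add.commute)
    have "1 + q * real (Suc d) > 0"
      using assms by (intro add_pos_nonneg) auto
    then show ?thesis
      unfolding denom numer using assms by simp
  qed
  have coeff_nonzero: "1 + q * real d \<noteq> 0" for d
    using assms by (smt (verit) mult_nonneg_nonneg of_nat_0_le_iff)
  show ?thesis
  proof
    assume rec: "?rec P"
    have "P (Suc d) = ?G (Suc d)" for d
    proof (induction d)
      case 0
      have "(1 + q) * P 1 = (1 + q) * ?G 1"
        unfolding start using rec[rule_format, of 1] by simp
      moreover have "1 + q \<noteq> 0"
        using assms by simp
      ultimately show ?case
        unfolding One_nat_def by (simp only: mult_cancel_left simp_thms)
    next
      case (Suc d)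
      have "(1 + q * real (Suc (Suc d))) * P (Suc (Suc d)) = q * real (Suc d) * ?G (Suc d)"
        using rec[rule_format, of "Suc (Suc d)"] by (simp add: Suc.IH)
      also have "\<dots> = (1 + q * real (Suc (Suc d))) * ?G (Suc (Suc d))"
        by (rule step[symmetric]) simp
      finally show ?case
        using coeff_nonzero mult_cancel_left by blast
    qed
    then show "\<forall>d\<ge>1. P d = ?G d"
      by (metis One_nat_def Suc_le_D)
  next
    assume closed: "\<forall>d\<ge>1. P d = ?G d"
    show "?rec P"
    proof (intro allI impI)
      fix d :: nat
      assume "1 \<le> d"
      then consider "d = 1" | e where "d = Suc e" "1 \<le> e"
        by (cases d) force+
      then show "(1 + q * real d) * P d = q * (real d - 1) * P (d - 1) + of_bool (d = 1)"
      proof cases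
        case 1
        have "P 1 = ?G 1"
          using closed by blast
        then have "(1 + q) * P 1 = (1 + q) * ?G 1"
          by (rule arg_cong)
        also note start
        finally show ?thesis
          using 1 by simp
      next
        case 2
        then show ?thesis using closed step[of e] by simp
      qed
    qed
  qed
qed

text \<open>
  Writing \<open>\<Gamma> n\<close> as \<open>(n - 1)!\<close> and \<open>\<Gamma> (a + n) / \<Gamma> a\<close> as a rising factorial turns the terms with
  \<open>n > 0\<close> into those of Gauss's product formula.
\<close>
lemma Gamma_ratio_power_tail:
  fixes a :: real
  assumes "0 < a"
  shows "(\<lambda>n. Gamma (real n) * Gamma a / Gamma (a + real n) * real n powr a) \<longlonglongrightarrow> Gamma a"
proof -
  have "a \<notin> \<int>\<^sub>\<le>\<^sub>0"
    using assms by (auto elim!: nonpos_Ints_cases)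
  then have "Gamma_series' a n = Gamma (real n) * Gamma a / Gamma (a + real n) * real n powr a"
    if "0 < n" for n
    using that Gamma_fact[of "n - 1", where ?'a = real]
    by (simp add: Gamma_series'_def pochhammer_Gamma powr_def of_nat_diff)
  then have "\<forall>\<^sub>F n in sequentially. Gamma_series' a n =
      Gamma (real n) * Gamma a / Gamma (a + real n) * real n powr a"
    by (rule eventually_mono[OF eventually_gt_at_top[of 0]])
  then show ?thesis
    by (rule Lim_transform_eventually[OF Gamma_series'_LIMSEQ])
qed

theorem theorem1:
  fixes p :: real
  assumes "0 < p" and "p < 1"
  shows "1 / (1 - p) + 1 > 2 \<and>
    (\<exists>C>0. \<forall>(M :: 'a measure) X Y E Xbar Ybar.
       pref_attachment_hypergraph M X Y E \<longrightarrow>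
       has_limiting_mean M X Xbar \<longrightarrow> has_limiting_mean M Y Ybar \<longrightarrow>
       0 < Xbar \<longrightarrow> 0 < Ybar \<longrightarrow> p = Xbar / Ybar \<longrightarrow>
       (\<forall>P. stationary_hyperdegree_distribution Xbar Ybar P \<longleftrightarrow>
          (\<forall>d\<ge>1. P d = Gamma (real d) * Gamma (1 / (1 - p) + 1) /
                         ((1 - p) * Gamma (1 / (1 - p) + real d + 1)))) \<and>
       (\<forall>P. stationary_hyperdegree_distribution Xbar Ybar P \<longrightarrow>
          (\<lambda>d. P d * real d powr (1 / (1 - p) + 1)) \<longlonglongrightarrow> C))"
proof -
  define \<gamma> where "\<gamma> = 1 / (1 - p) + 1"
  have exponent: "\<gamma> > 2"
    using assms by (simp add: \<gamma>_def)
  let ?G = "\<lambda>d. Gamma (real d) * Gamma (1 / (1 - p) + 1) /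
                  ((1 - p) * Gamma (1 / (1 - p) + real d + 1))"
  have stationary_iff: "stationary_hyperdegree_distribution \<mu> \<nu> P \<longleftrightarrow> (\<forall>d\<ge>1. P d = ?G d)"
    if "0 < \<mu>" "0 < \<nu>" "p = \<mu> / \<nu>" for \<mu> \<nu> P
    using stationary_iff_recurrence[OF that(1,2), of P] recurrence_iff_Gamma_ratio[of "1 - p" P]
      assms that(3) by simp
  have power_law: "(\<lambda>d. P d * real d powr \<gamma>) \<longlonglongrightarrow> Gamma \<gamma> / (1 - p)"
    if "\<forall>d\<ge>1. P d = ?G d" for P :: "nat \<Rightarrow> real"
  proof -
    let ?H = "\<lambda>d. Gamma (real d) * Gamma \<gamma> / Gamma (\<gamma> + real d) * real d powr \<gamma> / (1 - p)"
    have "?H \<longlonglongrightarrow> Gamma \<gamma> / (1 - p)"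
      using assms exponent by (intro tendsto_divide Gamma_ratio_power_tail tendsto_const) auto
    moreover have "?H d = P d * real d powr \<gamma>" if "1 \<le> d" for d
    proof -
      have shift: "1 / (1 - p) + real d + 1 = \<gamma> + real d"
        by (simp add: \<gamma>_def)
      have "P d = ?G d"
        using \<open>\<forall>d\<ge>1. P d = ?G d\<close> that by blast
      also have "\<dots> = Gamma (real d) * Gamma \<gamma> / ((1 - p) * Gamma (\<gamma> + real d))"
        unfolding shift unfolding \<gamma>_def ..
      finally show ?thesis
        by simp
    qed
    then have "\<forall>\<^sub>F d in sequentially. ?H d = P d * real d powr \<gamma>"
      by (rule eventually_sequentiallyI)
    ultimately show ?thesis
      by (rule Lim_transform_eventually)
  qed
  show ?thesis
    unfolding \<gamma>_def[symmetric]
  proof (intro conjI exI[of _ "Gamma \<gamma> / (1 - p)"] allI impI)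
    show "2 < \<gamma>"
      by (rule exponent)
    show "0 < Gamma \<gamma> / (1 - p)"
      using assms exponent by (simp add: Gamma_real_pos)
  next
    fix \<mu> \<nu> :: real and P :: "nat \<Rightarrow> real"
    assume means: "0 < \<mu>" "0 < \<nu>" "p = \<mu> / \<nu>"
    show "stationary_hyperdegree_distribution \<mu> \<nu> P \<longleftrightarrow>
        (\<forall>d\<ge>1. P d = Gamma (real d) * Gamma \<gamma> / ((1 - p) * Gamma (1 / (1 - p) + real d + 1)))"
      unfolding \<gamma>_def by (rule stationary_iff[OF means])
    assume "stationary_hyperdegree_distribution \<mu> \<nu> P"
    then show "(\<lambda>d. P d * real d powr \<gamma>) \<longlonglongrightarrow> Gamma \<gamma> / (1 - p)"
      using stationary_iff[OF means] by (intro power_law) simp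
  qed
qed

end
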